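(* Let $-\infty\le a<b\le\infty$, and let $f,g\colon(a,b)\to\mathbb{R}$ be differentiable functions such that $g(x)\neq 0$ and $g'(x)\neq 0$ for every $x\in(a,b)$. Put $r:=f/g$ and $\rho:=f'/g'$ on $(a,b)$. Then: (1) if $\rho$ is non-decreasing on $(a,b)$ and $gg'>0$ on $(a,b)$, then $r$ has the down-up pattern on $(a,b)$; (2) if $\rho$ is non-increasing on $(a,b)$ and $gg'>0$ on $(a,b)$, then $r$ has the up-down pattern on $(a,b)$; (3) if $\rho$ is non-decreasing on $(a,b)$ and $gg'<0$ on $(a,b)$, then $r$ has the up-down pattern on $(a,b)$; (4) if $\rho$ is non-increasing on $(a,b)$ and $gg'<0$ on $(a,b)$, then $r$ has the down-up pattern on $(a,b)$. Here "$r$ has the down-up pattern on $(a,b)$" means that there exist $c,d$ with $a\le c\le d\le b$ such that $r'<0$ on $(a,c)$, $r$ is constant on $(c,d)$, and $r'>0$ on $(d,b)$; and "$r$ has the up-down pattern on $(a,b)$" means that there exist $c,d$ with $a\le c\le d\le b$ such that $r'>0$ on $(a,c)$, $r$ is constant on $(c,d)$, and $r'<0$ on $(d,b)$.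
   Context: Endpoints $a,b,c,d$ are extended real numbers. The intervals $(a,c)$, $(c,d)$, $(d,b)$ may be empty (when $c=a$, $c=d$, $d=b$ respectively), in which case the corresponding condition is vacuous. Monotonicity is non-strict: "non-decreasing" and "non-increasing" allow constancy on subintervals. No continuity of $f'$ or $g'$ is assumed. *)

theory Defs
  imports "HOL-Analysis.Analysis"
begin

text \<open>Each sign condition on the derivative includes the existence of that derivative, since
  \<^const>\<open>deriv\<close> has an arbitrary value at points of non-differentiability.\<close>

definition down_up_pattern :: "(real \<Rightarrow> real) \<Rightarrow> ereal \<Rightarrow> ereal \<Rightarrow> bool" where
  "down_up_pattern r a b \<longleftrightarrow>
     (\<exists>c d. a \<le> c \<and> c \<le> d \<and> d \<le> b \<and>
        (\<forall>x\<in>einterval a c. r differentiable at x \<and> deriv r x < 0) \<and>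
        r constant_on einterval c d \<and>
        (\<forall>x\<in>einterval d b. r differentiable at x \<and> deriv r x > 0))"

definition up_down_pattern :: "(real \<Rightarrow> real) \<Rightarrow> ereal \<Rightarrow> ereal \<Rightarrow> bool" where
  "up_down_pattern r a b \<longleftrightarrow>
     (\<exists>c d. a \<le> c \<and> c \<le> d \<and> d \<le> b \<and>
        (\<forall>x\<in>einterval a c. r differentiable at x \<and> deriv r x > 0) \<and>
        r constant_on einterval c d \<and>
        (\<forall>x\<in>einterval d b. r differentiable at x \<and> deriv r x < 0))"

end

theory Submission
  imports Defs
begin

text \<open>Write \<open>\<rho> = f' / g'\<close> and \<open>r = f / g\<close>. The quotient rule gives
  \<open>r' = (g' / g) * (\<rho> - r)\<close>, so where \<open>g * g'\<close> has constant sign, the sign of \<open>r'\<close> is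
  governed by that of \<open>\<rho> - r\<close>. This function need not be monotone, but its positive multiple
  \<open>h = \<bar>g\<bar> * (\<rho> - r)\<close> is: by Cauchy's mean value theorem, for \<open>x < y\<close> there is a \<open>z\<close>
  strictly between them with
  \<open>h y - h x = (\<rho> y - \<rho> z) * \<bar>g y\<bar> + (\<rho> z - \<rho> x) * \<bar>g x\<bar>\<close>,
  which is nonnegative for non-decreasing \<open>\<rho>\<close> (\<open>mono_on_abs_times_ratio_gap\<close>).
  Hence the sets where \<open>h < 0\<close>, \<open>h = 0\<close> and \<open>h > 0\<close> follow one another from left to right, and
  the points that separate them are the \<open>c\<close> and \<open>d\<close> of the pattern
  (\<open>down_up_pattern_if_deriv_mono_factor\<close>). Changing the sign of \<open>r\<close> covers negative \<open>g * g'\<close>, and changing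
  that of \<open>f\<close> covers non-increasing \<open>\<rho>\<close>.\<close>

lemma convex_einterval: "convex (einterval a b)"
proof -
  have "is_interval (einterval a b)"
    unfolding is_interval_1
    by (auto simp: einterval_iff)
      (meson ereal_less_eq(3) less_le_trans le_less_trans)+
  then show ?thesis by (rule is_interval_convex)
qed

text \<open>Monotonicity orders the sets where \<open>h\<close> is negative, zero and positive from left to right, and
  these are the sets where \<open>r\<close> has negative, zero and positive derivative. So \<open>c\<close> and
  \<open>d\<close> are the right end of the negative set and the left end of the positive one.\<close>

lemma down_up_pattern_if_deriv_mono_factor:
  fixes r h w :: "real \<Rightarrow> real" and a b :: ereal
  assumes "a < b"
    and mono: "mono_on (einterval a b) h"
    and deriv: "\<And>x. x \<in> einterval a b \<Longrightarrow> (r has_real_derivative w x * h x) (at x)"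
    and pos: "\<And>x. x \<in> einterval a b \<Longrightarrow> w x > 0"
  shows "down_up_pattern r a b"
proof -
  let ?I = "einterval a b"
  \<comment> \<open>Inserting the endpoints gives the right values when \<open>h\<close> has no negative or no positive
    values, where the supremum and the infimum would otherwise be infinite.\<close>
  define c where "c = Sup (insert a (ereal ` {x\<in>?I. h x < 0}))"
  define d where "d = Inf (insert b (ereal ` {x\<in>?I. h x > 0}))"
  have ac: "a \<le> c" unfolding c_def by (rule Sup_upper) simp
  have db: "d \<le> b" unfolding d_def by (rule Inf_lower) simp
  have cd: "c \<le> d" unfolding c_def
  proof (rule Sup_least)
    fix u assume u: "u \<in> insert a (ereal ` {x\<in>?I. h x < 0})"
    show "u \<le> d" unfolding d_def
    proof (rule Inf_greatest)
      fix v assume v: "v \<in> insert b (ereal ` {x\<in>?I. h x > 0})"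
      have sep: "x \<le> y" if "x \<in> ?I" "y \<in> ?I" "h x < 0" "h y > 0" for x y
        using mono_onD[OF mono \<open>y \<in> ?I\<close> \<open>x \<in> ?I\<close>] that by linarith
      show "u \<le> v"
        using u v \<open>a < b\<close> sep by (auto simp: einterval_iff intro: less_imp_le)
    qed
  qed
  have left: "x \<in> ?I \<and> h x < 0" if x: "x \<in> einterval a c" for x
  proof -
    have "ereal x < c" "a < ereal x" using x by (auto simp: einterval_iff)
    then obtain y where y: "y \<in> ?I" "h y < 0" "x < y"
      unfolding c_def less_Sup_iff by auto
    have xI: "x \<in> ?I"
      using \<open>a < ereal x\<close> y(1,3) by (auto simp: einterval_iff intro: less_trans[of "ereal x" "ereal y"])
    show ?thesis using mono_onD[OF mono xI y(1)] y xI by auto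
  qed
  have right: "x \<in> ?I \<and> h x > 0" if x: "x \<in> einterval d b" for x
  proof -
    have "d < ereal x" "ereal x < b" using x by (auto simp: einterval_iff)
    then obtain y where y: "y \<in> ?I" "h y > 0" "y < x"
      unfolding d_def Inf_less_iff by auto
    have xI: "x \<in> ?I"
      using \<open>ereal x < b\<close> y(1,3) by (auto simp: einterval_iff intro: less_trans[of _ "ereal y" "ereal x"])
    show ?thesis using mono_onD[OF mono y(1) xI] y xI by auto
  qed
  have mid: "x \<in> ?I \<and> h x = 0" if x: "x \<in> einterval c d" for x
  proof -
    have cx: "c < ereal x" and xd: "ereal x < d" using x by (auto simp: einterval_iff)
    have xI: "x \<in> ?I"
      using le_less_trans[OF ac cx] less_le_trans[OF xd db] by (auto simp: einterval_iff)
    have "\<not> h x < 0"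
    proof
      assume "h x < 0"
      then have "ereal x \<le> c" unfolding c_def using xI by (intro Sup_upper) auto
      then show False using cx by simp
    qed
    moreover have "\<not> h x > 0"
    proof
      assume "h x > 0"
      then have "d \<le> ereal x" unfolding d_def using xI by (intro Inf_lower) auto
      then show False using xd by simp
    qed
    ultimately show ?thesis using xI by auto
  qed
  have "(r has_field_derivative 0) (at x within einterval c d)" if "x \<in> einterval c d" for x
    using deriv[of x] mid[OF that] by (auto intro: has_field_derivative_at_within)
  then have "r constant_on einterval c d"
    unfolding constant_on_def by (rule has_field_derivative_zero_constant[OF convex_einterval])
  moreover have "r differentiable at x \<and> deriv r x < 0" if "x \<in> einterval a c" for x
    using left[OF that] deriv[of x] pos[of x]
    by (auto simp: DERIV_imp_deriv real_differentiable_def mult_pos_neg)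
  moreover have "r differentiable at x \<and> deriv r x > 0" if "x \<in> einterval d b" for x
    using right[OF that] deriv[of x] pos[of x]
    by (auto simp: DERIV_imp_deriv real_differentiable_def)
  ultimately show ?thesis
    unfolding down_up_pattern_def using ac cd db by blast
qed

lemma up_down_pattern_if_down_up_pattern_uminus:
  assumes "down_up_pattern (\<lambda>x. - r x) a b"
  shows "up_down_pattern r a b"
proof -
  have *: "r differentiable at x \<and> deriv r x = - deriv (\<lambda>x. - r x) x"
    if diff: "(\<lambda>x. - r x) differentiable at x" for x
  proof -
    obtain D where "((\<lambda>x. - r x) has_real_derivative D) (at x)"
      using diff unfolding real_differentiable_def by blast
    moreover from DERIV_minus[OF this] have "(r has_real_derivative - D) (at x)" by simp
    ultimately show ?thesis
      using DERIV_imp_deriv real_differentiable_def by metis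
  qed
  have "r constant_on S" if "(\<lambda>x. - r x) constant_on S" for S
    using that unfolding constant_on_def by (metis minus_equation_iff)
  then show ?thesis
    using assms * unfolding down_up_pattern_def up_down_pattern_def
    by (metis neg_0_less_iff_less neg_less_0_iff_less)
qed

lemma same_sgn_if_nonzero_on_convex:
  fixes g :: "real \<Rightarrow> real"
  assumes "convex S" "continuous_on S g" "0 \<notin> g ` S" "x \<in> S" "y \<in> S"
  shows "sgn (g x) = sgn (g y)"
proof -
  have "connected (g ` S)"
    using assms(1,2) convex_connected connected_continuous_image by blast
  then have "convex (g ` S)" by (simp add: connected_convex_1)
  then have "closed_segment (g x) (g y) \<subseteq> g ` S"
    using assms(4,5) by (simp add: closed_segment_subset)
  then have "0 \<notin> closed_segment (g x) (g y)" using assms(3) by auto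
  then show ?thesis
    by (auto simp: closed_segment_eq_real_ivl sgn_if split: if_splits)
qed

text \<open>Since \<open>\<bar>g\<bar> * (\<rho> - f / g) = \<plusminus> (\<rho> * g - f)\<close> with a fixed sign, it suffices to study
  \<open>\<rho> * g - f\<close>. The increment of \<open>f\<close> is \<open>\<rho> z\<close> times that of \<open>g\<close> for an intermediate \<open>z\<close>, so the
  increment of \<open>\<rho> * g - f\<close> is a combination of the increments of \<open>\<rho>\<close> from \<open>x\<close> to \<open>z\<close> and from \<open>z\<close>
  to \<open>y\<close>, with coefficients \<open>g x\<close> and \<open>g y\<close>.\<close>

lemma mono_on_abs_times_ratio_gap:
  fixes f g f' g' :: "real \<Rightarrow> real"
  assumes S: "convex S"
    and f: "\<And>x. x \<in> S \<Longrightarrow> (f has_real_derivative f' x) (at x)"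
    and g: "\<And>x. x \<in> S \<Longrightarrow> (g has_real_derivative g' x) (at x)"
    and nz: "\<And>x. x \<in> S \<Longrightarrow> g x \<noteq> 0" "\<And>x. x \<in> S \<Longrightarrow> g' x \<noteq> 0"
    and mono: "mono_on S (\<lambda>x. f' x / g' x)"
  shows "mono_on S (\<lambda>x. \<bar>g x\<bar> * (f' x / g' x - f x / g x))"
proof (rule mono_onI)
  fix x y assume xy: "x \<in> S" "y \<in> S" "x \<le> y"
  let ?\<rho> = "\<lambda>x. f' x / g' x"
  let ?s = "sgn (g x)"
  show "\<bar>g x\<bar> * (?\<rho> x - f x / g x) \<le> \<bar>g y\<bar> * (?\<rho> y - f y / g y)"
  proof (cases "x = y")
    case False
    then have "x < y" using xy by simp
    have in_S: "t \<in> S" if "x \<le> t" "t \<le> y" for t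
      using closed_segment_subset[OF xy(1,2) S] that by (auto simp: closed_segment_eq_real_ivl)
    have "\<exists>z. x < z \<and> z < y \<and> (f y - f x) * g' z = (g y - g x) * f' z"
      by (rule GMVT'[OF \<open>x < y\<close>]) (auto intro: DERIV_isCont[OF f] DERIV_isCont[OF g] intro!: f g in_S)
    then obtain z where z: "x < z" "z < y" "(f y - f x) * g' z = (g y - g x) * f' z" by blast
    have zS: "z \<in> S" using in_S z by simp
    have cauchy: "f y - f x = ?\<rho> z * (g y - g x)"
      using z(3) nz(2)[OF zS] by (simp add: field_simps)
    have "continuous_on S g"
      using g by (meson DERIV_isCont continuous_at_imp_continuous_on)
    moreover have "0 \<notin> g ` S" using nz(1) by force
    ultimately have sgn: "sgn (g y) = ?s"
      using same_sgn_if_nonzero_on_convex[OF S] xy by blast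
    have gap: "\<bar>g t\<bar> * (?\<rho> t - f t / g t) = sgn (g t) * (?\<rho> t * g t - f t)" if "t \<in> S" for t
      using nz(1)[OF that] by (simp add: abs_sgn algebra_simps)
    have "\<bar>g y\<bar> * (?\<rho> y - f y / g y) - \<bar>g x\<bar> * (?\<rho> x - f x / g x)
        = ?s * (?\<rho> y * g y - ?\<rho> x * g x - (f y - f x))"
      unfolding gap[OF xy(1)] gap[OF xy(2)] sgn by (simp only: algebra_simps)
    also have "\<dots> = (?\<rho> y - ?\<rho> z) * (g y * ?s) + (?\<rho> z - ?\<rho> x) * (g x * ?s)"
      unfolding cauchy by (simp only: algebra_simps)
    also have "\<dots> = (?\<rho> y - ?\<rho> z) * \<bar>g y\<bar> + (?\<rho> z - ?\<rho> x) * \<bar>g x\<bar>"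
      using sgn by (simp add: abs_sgn)
    also have "\<dots> \<ge> 0"
      using mono_onD[OF mono xy(1) zS] mono_onD[OF mono zS xy(2)] z(1,2) by simp
    finally show ?thesis by simp
  qed simp
qed

text \<open>Both signs of \<open>g * g'\<close> share the monotone factor \<open>\<bar>g\<bar> * (\<rho> - r)\<close> of \<open>r'\<close>; only the
  remaining factor \<open>g' / (g * \<bar>g\<bar>)\<close> changes sign.\<close>

lemma ratio_patterns_if_deriv_ratio_mono:
  fixes f g f' g' :: "real \<Rightarrow> real" and a b :: ereal
  assumes "a < b"
    and f: "\<And>x. x \<in> einterval a b \<Longrightarrow> (f has_real_derivative f' x) (at x)"
    and g: "\<And>x. x \<in> einterval a b \<Longrightarrow> (g has_real_derivative g' x) (at x)"
    and nz: "\<And>x. x \<in> einterval a b \<Longrightarrow> g x \<noteq> 0" "\<And>x. x \<in> einterval a b \<Longrightarrow> g' x \<noteq> 0"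
    and mono: "mono_on (einterval a b) (\<lambda>x. f' x / g' x)"
  shows "(\<And>x. x \<in> einterval a b \<Longrightarrow> g x * g' x > 0) \<Longrightarrow> down_up_pattern (\<lambda>x. f x / g x) a b"
    and "(\<And>x. x \<in> einterval a b \<Longrightarrow> g x * g' x < 0) \<Longrightarrow> down_up_pattern (\<lambda>x. - (f x / g x)) a b"
proof -
  let ?h = "\<lambda>x. \<bar>g x\<bar> * (f' x / g' x - f x / g x)"
  let ?w = "\<lambda>x. g' x / (g x * \<bar>g x\<bar>)"
  have h: "mono_on (einterval a b) ?h"
    by (rule mono_on_abs_times_ratio_gap[OF convex_einterval f g nz mono])
  have r: "((\<lambda>x. f x / g x) has_real_derivative ?w x * ?h x) (at x)"
    if "x \<in> einterval a b" for x
  proof -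
    have "(f' x * g x - f x * g' x) / (g x * g x) = ?w x * ?h x"
      using nz[OF that] by (simp add: field_simps)
    then show ?thesis
      using DERIV_divide[OF f[OF that] g[OF that] nz(1)[OF that]] by simp
  qed
  have w: "?w x = g x * g' x / (g x * g x * \<bar>g x\<bar>)" if "x \<in> einterval a b" for x
    using nz(1)[OF that] by simp
  have den: "g x * g x * \<bar>g x\<bar> > 0" if "x \<in> einterval a b" for x
    using nz(1)[OF that] by (auto simp: zero_less_mult_iff)
  show "down_up_pattern (\<lambda>x. f x / g x) a b" if "\<And>x. x \<in> einterval a b \<Longrightarrow> g x * g' x > 0"
  proof (rule down_up_pattern_if_deriv_mono_factor[OF \<open>a < b\<close> h r])
    show "?w x > 0" if "x \<in> einterval a b" for x
      unfolding w[OF that] by (intro divide_pos_pos den that \<open>\<And>x. x \<in> _ \<Longrightarrow> g x * g' x > 0\<close>)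
  qed
  show "down_up_pattern (\<lambda>x. - (f x / g x)) a b" if "\<And>x. x \<in> einterval a b \<Longrightarrow> g x * g' x < 0"
  proof (rule down_up_pattern_if_deriv_mono_factor[OF \<open>a < b\<close> h])
    show "((\<lambda>x. - (f x / g x)) has_real_derivative - ?w x * ?h x) (at x)"
      if "x \<in> einterval a b" for x
      using DERIV_minus[OF r[OF that]] by simp
    show "- ?w x > 0" if "x \<in> einterval a b" for x
      unfolding neg_0_less_iff_less w[OF that]
      by (intro divide_neg_pos den that \<open>\<And>x. x \<in> _ \<Longrightarrow> g x * g' x < 0\<close>)
  qed
qed

theorem proposition1:
  fixes a b :: ereal and f g :: "real \<Rightarrow> real"
  assumes "a < b"
    and "\<forall>x\<in>einterval a b. f differentiable at x"
    and "\<forall>x\<in>einterval a b. g differentiable at x"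
    and "\<forall>x\<in>einterval a b. g x \<noteq> 0"
    and "\<forall>x\<in>einterval a b. deriv g x \<noteq> 0"
  shows
    "(mono_on (einterval a b) (\<lambda>x. deriv f x / deriv g x) \<and>
        (\<forall>x\<in>einterval a b. g x * deriv g x > 0)
        \<longrightarrow> down_up_pattern (\<lambda>x. f x / g x) a b) \<and>
     (antimono_on (einterval a b) (\<lambda>x. deriv f x / deriv g x) \<and>
        (\<forall>x\<in>einterval a b. g x * deriv g x > 0)
        \<longrightarrow> up_down_pattern (\<lambda>x. f x / g x) a b) \<and>
     (mono_on (einterval a b) (\<lambda>x. deriv f x / deriv g x) \<and>
        (\<forall>x\<in>einterval a b. g x * deriv g x < 0)
        \<longrightarrow> up_down_pattern (\<lambda>x. f x / g x) a b) \<and>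
     (antimono_on (einterval a b) (\<lambda>x. deriv f x / deriv g x) \<and>
        (\<forall>x\<in>einterval a b. g x * deriv g x < 0)
        \<longrightarrow> down_up_pattern (\<lambda>x. f x / g x) a b)"
proof (intro conjI impI; elim conjE)
  let ?I = "einterval a b"
  have f: "(f has_real_derivative deriv f x) (at x)" if "x \<in> ?I" for x
    using assms(2) that by (simp add: DERIV_deriv_iff_real_differentiable)
  have g: "(g has_real_derivative deriv g x) (at x)" if "x \<in> ?I" for x
    using assms(3) that by (simp add: DERIV_deriv_iff_real_differentiable)
  have minus_f: "((\<lambda>x. - f x) has_real_derivative - deriv f x) (at x)" if "x \<in> ?I" for x
    by (rule DERIV_minus[OF f[OF that]])
  have nz: "g x \<noteq> 0" "deriv g x \<noteq> 0" if "x \<in> ?I" for x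
    using assms(4,5) that by auto
  have minus_mono: "mono_on ?I (\<lambda>x. - deriv f x / deriv g x)"
    if "antimono_on ?I (\<lambda>x. deriv f x / deriv g x)"
    using that by (auto simp: monotone_on_def)
  note up = ratio_patterns_if_deriv_ratio_mono[OF \<open>a < b\<close> f g nz]
  note down = ratio_patterns_if_deriv_ratio_mono[OF \<open>a < b\<close> minus_f g nz minus_mono]
  show "down_up_pattern (\<lambda>x. f x / g x) a b"
    if "mono_on ?I (\<lambda>x. deriv f x / deriv g x)" "\<forall>x\<in>?I. g x * deriv g x > 0"
    using up(1) that by blast
  show "up_down_pattern (\<lambda>x. f x / g x) a b"
    if "antimono_on ?I (\<lambda>x. deriv f x / deriv g x)" "\<forall>x\<in>?I. g x * deriv g x > 0"
    using down(1) that by (intro up_down_pattern_if_down_up_pattern_uminus) simp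
  show "up_down_pattern (\<lambda>x. f x / g x) a b"
    if "mono_on ?I (\<lambda>x. deriv f x / deriv g x)" "\<forall>x\<in>?I. g x * deriv g x < 0"
    using up(2) that by (intro up_down_pattern_if_down_up_pattern_uminus) blast
  show "down_up_pattern (\<lambda>x. f x / g x) a b"
    if "antimono_on ?I (\<lambda>x. deriv f x / deriv g x)" "\<forall>x\<in>?I. g x * deriv g x < 0"
    using down(2) that by simp
qed

end
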